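(* Let $\Lambda>0$, $\eta>0$, $x_1,\dots,x_M\in\mathbb{R}$, $z_k=x_k+i\eta$, $d=2M$, and let $\theta\mapsto H(\theta)$, $\theta\in B(0,r_d)\subset\mathbb{R}^{d}$, be a family of trace-normed Hamiltonians on $[0,\Lambda]$ with free tail. Let $\mathcal{S}(\theta)=(v_{H(\theta),\Lambda}(z_k))_{k=1}^M$ and let $\mathcal{S}_{\mathbb{R}}:B(0,r_d)\to\mathbb{R}^{2M}$ be its realification. Assume that $\mathcal{S}_{\mathbb{R}}$ is $C^1$ on $B(0,r_d)$, that there is $B\ge0$ with $\|D\mathcal{S}_{\mathbb{R}}(\theta)-D\mathcal{S}_{\mathbb{R}}(\widetilde\theta)\|_{2\to2}\le B\|\theta-\widetilde\theta\|_2$ for all $\theta,\widetilde\theta\in B(0,r_d)$, and that $J_{\mathbb{R}}:=D\mathcal{S}_{\mathbb{R}}(0)$ satisfies $\alpha:=\sigma_{\min}(J_{\mathbb{R}})>0$. Set $$M_0:=\alpha^{-1},\qquad r:=\min\Big\{r_d,\frac{1}{2BM_0}\Big\},\qquad\delta:=\frac{r}{2M_0},$$ with the convention $1/(2BM_0)=+\infty$ when $B=0$. Then: (i) for every $y\in\mathbb{C}^M$ with $\|y-\mathcal{S}(0)\|_2\le\delta$ there exists a unique $\theta\in B(0,r)$ with $\mathcal{S}(\theta)=y$; write $\theta=\mathcal{S}^{-1}(y)$; (ii) for all $y,\widetilde y\in\mathbb{C}^M$ within distance $\delta$ of $\mathcal{S}(0)$, $\|\mathcal{S}^{-1}(y)-\mathcal{S}^{-1}(\widetilde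 y)\|_2\le2M_0\|y-\widetilde y\|_2$; (iii) for every such $y$, the map $\mathcal{G}_{y,\mathbb{R}}(\theta):=\theta-J_{\mathbb{R}}^{-1}(\mathcal{S}_{\mathbb{R}}(\theta)-y_{\mathbb{R}})$ is a contraction on $B(0,r)$, and its iterates converge to the unique local solution $\mathcal{S}^{-1}(y)$.
   Context: Let $J=\begin{pmatrix}0&-1\\1&0\end{pmatrix}$. A trace-normed Hamiltonian on $[0,\Lambda]$ is a measurable $H:[0,\Lambda]\to\mathbb{R}^{2\times2}$ with $H(s)$ symmetric, $H(s)\succeq0$ and $\operatorname{tr}H(s)=1$ for a.e. $s$; it is extended to $[0,\infty)$ by the free tail $H(s)=\frac12I$ for $s\ge\Lambda$. For $\operatorname{Im}z>0$, the Weyl coefficient $m_{H,\Lambda}(z)$ is the unique $m\in\mathbb{C}$ such that the solution of $JY'(s)=zH(s)Y(s)$ on $[0,\infty)$ with $Y(0)=(1,m)^\top$ is square-integrable, i.e. $\int_0^\infty Y^*HY\,ds<\infty$; it satisfies $\operatorname{Im}m_{H,\Lambda}(z)>0$. Its Schur transform is $v_{H,\Lambda}(z)=\dfrac{m_{H,\Lambda}(z)-i}{m_{H,\Lambda}(z)+i}$. $\mathbb{C}^M$ is identified with $\mathbb{R}^{2M}$ via real and imaginary parts; $y_{\mathbb{R}}\in\mathbb{R}^{2M}$ is the image of $y\in\mathbb{C}^M$. $B(0,r)$ is the open Euclidean ball in $\mathbb{R}^d$, $\|\cdot\|_{2\to2}$ the operator norm between Euclidean spaces, and $\sigma_{\min}(A)=\min_{\|u\|_2=1}\|Au\|_2$.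 *)

theory Defs
  imports "HOL-Analysis.Analysis"
begin

definition J_mat :: "real^2^2" where
  "J_mat = vector [vector [0, -1], vector [1, 0]]"

text \<open>Only the values of \<open>H\<close> on \<open>[0,\<Lambda>]\<close> matter; "measurable" means Lebesgue measurable.\<close>

definition trace_normed_hamiltonian :: "real \<Rightarrow> (real \<Rightarrow> real^2^2) \<Rightarrow> bool" where
  "trace_normed_hamiltonian \<Lambda> H \<longleftrightarrow>
     H \<in> borel_measurable (lebesgue_on {0..\<Lambda>}) \<and>
     (AE s in lebesgue_on {0..\<Lambda>}.
        transpose (H s) = H s \<and> (\<forall>u. 0 \<le> u \<bullet> (H s *v u)) \<and> trace (H s) = 1)"

definition free_tail :: "real \<Rightarrow> (real \<Rightarrow> real^2^2) \<Rightarrow> real \<Rightarrow> real^2^2" where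
  "free_tail \<Lambda> H s = (if s < \<Lambda> then H s else (1/2) *\<^sub>R mat 1)"

definition abs_continuous_on :: "real \<Rightarrow> real \<Rightarrow> (real \<Rightarrow> 'a::real_normed_vector) \<Rightarrow> bool" where
  "abs_continuous_on a b f \<longleftrightarrow>
     (\<forall>\<epsilon>>0. \<exists>\<delta>>0. \<forall>(n::nat) u v.
        (\<forall>i<n. a \<le> u i \<and> u i \<le> v i \<and> v i \<le> b) \<and>
        (\<forall>i<n. \<forall>j<n. i \<noteq> j \<longrightarrow> {u i<..<v i} \<inter> {u j<..<v j} = {}) \<and>
        (\<Sum>i<n. v i - u i) < \<delta> \<longrightarrow>
        (\<Sum>i<n. norm (f (v i) - f (u i))) < \<epsilon>)"

text \<open>As \<open>H\<close> is only measurable, a solution on \<open>[0,\<infinity>)\<close> is a locally absolutely continuous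
  function satisfying the equation almost everywhere.\<close>

definition canonical_solution ::
    "(real \<Rightarrow> real^2^2) \<Rightarrow> complex \<Rightarrow> (real \<Rightarrow> complex^2) \<Rightarrow> bool" where
  "canonical_solution H z Y \<longleftrightarrow>
     (\<forall>T\<ge>0. abs_continuous_on 0 T Y) \<and>
     (AE s in lebesgue. s > 0 \<longrightarrow>
        (\<exists>Y'. (Y has_vector_derivative Y') (at s) \<and>
              map_matrix complex_of_real J_mat *v Y'
                = z *s (map_matrix complex_of_real (H s) *v Y s)))"

text \<open>The form \<open>Y\<^sup>*HY\<close>; it is real and nonnegative when \<open>H\<close> is real, symmetric and positive
  semidefinite, so \<open>Re\<close> and \<open>ennreal\<close> below lose nothing.\<close>

definition hermitian_form :: "real^2^2 \<Rightarrow> complex^2 \<Rightarrow> complex" where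
  "hermitian_form A y = (\<Sum>i\<in>UNIV. cnj (y $ i) * (map_matrix complex_of_real A *v y) $ i)"

definition square_integrable :: "(real \<Rightarrow> real^2^2) \<Rightarrow> (real \<Rightarrow> complex^2) \<Rightarrow> bool" where
  "square_integrable H Y \<longleftrightarrow>
     (\<integral>\<^sup>+ s\<in>{0..}. ennreal (Re (hermitian_form (H s) (Y s))) \<partial>lebesgue) < \<infinity>"

definition weyl_coeff :: "(real \<Rightarrow> real^2^2) \<Rightarrow> real \<Rightarrow> complex \<Rightarrow> complex" where
  "weyl_coeff H \<Lambda> z = (THE m. \<exists>Y. canonical_solution (free_tail \<Lambda> H) z Y \<and>
     Y 0 = vector [1, m] \<and> square_integrable (free_tail \<Lambda> H) Y)"

definition schur_transform :: "(real \<Rightarrow> real^2^2) \<Rightarrow> real \<Rightarrow> complex \<Rightarrow> complex" where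
  "schur_transform H \<Lambda> z = (weyl_coeff H \<Lambda> z - \<i>) / (weyl_coeff H \<Lambda> z + \<i>)"

text \<open>With \<open>M = CARD('m)\<close>, the space \<open>\<real>\<^sup>2\<^sup>M\<close> is the type \<^typ>\<open>real^('m + 'm)\<close>: the summand \<open>Inl\<close>
  carries the real parts and \<open>Inr\<close> the imaginary parts.\<close>

definition realify :: "complex^'m \<Rightarrow> real^('m + 'm)" where
  "realify y = (\<chi> i. case i of Inl k \<Rightarrow> Re (y $ k) | Inr k \<Rightarrow> Im (y $ k))"

definition sample_map ::
    "('p \<Rightarrow> real \<Rightarrow> real^2^2) \<Rightarrow> real \<Rightarrow> complex^'m \<Rightarrow> 'p \<Rightarrow> complex^'m" where
  "sample_map H \<Lambda> z \<theta> = (\<chi> k. schur_transform (H \<theta>) \<Lambda> (z $ k))"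

definition sigma_min :: "('a::euclidean_space \<Rightarrow>\<^sub>L 'b::real_normed_vector) \<Rightarrow> real" where
  "sigma_min A = (INF u\<in>sphere 0 1. norm (blinfun_apply A u))"

text \<open>The infimum is a minimum, by compactness of the unit sphere.\<close>

lemma sigma_min_attained:
  fixes A :: "'a::euclidean_space \<Rightarrow>\<^sub>L 'b::real_normed_vector"
  shows "\<exists>u. norm u = 1 \<and> norm (blinfun_apply A u) = sigma_min A \<and>
             (\<forall>w. norm w = 1 \<longrightarrow> sigma_min A \<le> norm (blinfun_apply A w))"
proof -
  let ?f = "\<lambda>u. norm (blinfun_apply A u)"
  have "sphere (0::'a) 1 \<noteq> {}" by simp
  moreover have "continuous_on (sphere 0 1) ?f" by (intro continuous_intros)
  ultimately obtain u where u: "u \<in> sphere 0 1" "\<forall>w\<in>sphere 0 1. ?f u \<le> ?f w"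
    using continuous_attains_inf[OF compact_sphere] by blast
  have "sigma_min A = ?f u"
    unfolding sigma_min_def using u by (intro cInf_eq_minimum) auto
  with u show ?thesis by auto
qed

end

theory Submission
  imports Defs
begin

text \<open>With \<open>L = DS(0)\<inverse>\<close> and \<open>\<phi>(\<theta>) = \<theta> - L S(\<theta>)\<close> one has \<open>D\<phi>(\<theta>) = L (DS(0) - DS(\<theta>))\<close>, so \<open>\<phi>\<close> is
  Lipschitz with constant \<open>M\<^sub>0 B s \<le> 1/2\<close> on the ball of radius \<open>s \<le> r\<close>.  Hence the simplified Newton
  map \<open>G\<^sub>y = \<phi> + L y\<close>, whose fixed points are the solutions of \<open>S(\<theta>) = y\<close>, is a contraction.  To get a
  fixed point in the open ball even if \<open>y\<close> is at distance exactly \<open>\<delta>\<close>, pass from \<open>0\<close> to \<open>\<theta>\<close> via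
  \<open>\<theta>/2\<close>: the smaller Lipschitz constant on the first half yields \<open>\<parallel>\<phi>(\<theta>) - \<phi>(0)\<parallel> \<le> 3r/8\<close>, so \<open>G\<^sub>y\<close> maps
  the open ball into the closed ball of radius \<open>7r/8\<close>.\<close>

section \<open>Linear maps with positive smallest singular value\<close>

lemma sigma_min_mult_norm_le:
  fixes A :: "'a::euclidean_space \<Rightarrow>\<^sub>L 'b::real_normed_vector"
  shows "sigma_min A * norm u \<le> norm (A u)"
proof (cases "u = 0")
  case False
  have "norm (u /\<^sub>R norm u) = 1"
    using False by simp
  then have "sigma_min A \<le> norm (A (u /\<^sub>R norm u))"
    using sigma_min_attained by metis
  also have "\<dots> = norm (A u) / norm u"
    by (simp add: blinfun.scaleR_right divide_inverse_commute)
  finally show ?thesis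
    using False by (simp add: field_simps)
qed simp

text \<open>A trivial kernel gives injectivity, and equal finite dimensions turn this into
  bijectivity. The lower bound for \<open>A\<close>, taken at \<open>inv A w\<close>, is the upper
  bound for the inverse.\<close>

lemma
  fixes A :: "'a::euclidean_space \<Rightarrow>\<^sub>L 'a"
  assumes "sigma_min A > 0"
  shows bij_if_sigma_min_pos: "bij A"
    and norm_inv_le_if_sigma_min_pos: "norm (inv A w) \<le> inverse (sigma_min A) * norm w"
proof -
  have lin: "linear A"
    by (intro bounded_linear.linear blinfun.bounded_linear_right)
  have "u = 0" if "A u = 0" for u
    using sigma_min_mult_norm_le[of A u] that assms by (simp add: mult_le_0_iff)
  then have inj: "inj A"
    using linear_injective_0[OF lin] by blast
  then show bij: "bij A"
    using linear_injective_imp_surjective[OF lin] by (simp add: bij_def)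
  have "sigma_min A * norm (inv A w) \<le> norm w"
    using sigma_min_mult_norm_le[of A "inv A w"] bij by (simp add: bij_is_surj surj_f_inv_f)
  then show "norm (inv A w) \<le> inverse (sigma_min A) * norm w"
    using assms by (simp add: field_simps)
qed

section \<open>Iteration of a contraction\<close>

text \<open>The fixed point is given, so the set may be an open ball: each step shrinks the distance
  to \<open>p\<close> by the factor \<open>c\<close>.\<close>

lemma tendsto_funpow_contraction:
  fixes f :: "'a::metric_space \<Rightarrow> 'a"
  assumes c: "0 \<le> c" "c < 1" and inv: "f ` X \<subseteq> X" and lip: "c-lipschitz_on X f"
    and p: "p \<in> X" "f p = p" and "x \<in> X"
  shows "(\<lambda>n. (f ^^ n) x) \<longlonglongrightarrow> p"
proof -
  \<comment> \<open>Membership in \<open>X\<close> is carried along because the Lipschitz bound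
    holds only there.\<close>
  have iter: "(f ^^ n) x \<in> X \<and> dist ((f ^^ n) x) p \<le> c ^ n * dist x p" for n
  proof (induction n)
    case (Suc n)
    have "dist (f ((f ^^ n) x)) p \<le> c * dist ((f ^^ n) x) p"
      using lipschitz_onD[OF lip, of "(f ^^ n) x" p] Suc p by auto
    also have "\<dots> \<le> c * (c ^ n * dist x p)"
      using Suc c by (intro mult_left_mono) auto
    finally show ?case
      using Suc inv by (auto simp: mult.assoc)
  qed (use \<open>x \<in> X\<close> in simp)
  have "(\<lambda>n. c ^ n * dist x p) \<longlonglongrightarrow> 0"
    using LIMSEQ_realpow_zero[OF c] by (rule tendsto_mult_left_zero)
  then have "(\<lambda>n. dist ((f ^^ n) x) p) \<longlonglongrightarrow> 0"
    by (rule Lim_null_comparison[rotated]) (use iter in auto)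
  then show ?thesis
    by (rule iffD2[OF tendsto_dist_iff])
qed

section \<open>The simplified Newton method\<close>

text \<open>The radius condition \<open>BMr\<close> is written as a product, so that
  \<open>B = 0\<close> needs no convention about division.\<close>

locale simplified_newton =
  fixes f :: "'a::euclidean_space \<Rightarrow> 'a" and Df :: "'a \<Rightarrow> 'a \<Rightarrow>\<^sub>L 'a" and R B M r :: real
  assumes deriv: "\<And>\<theta>. \<theta> \<in> ball 0 R \<Longrightarrow> (f has_derivative Df \<theta>) (at \<theta>)"
    and Lip: "\<And>\<theta>. \<theta> \<in> ball 0 R \<Longrightarrow> norm (Df 0 - Df \<theta>) \<le> B * norm \<theta>"
    and sigma_pos: "sigma_min (Df 0) > 0"
    and M_def: "M = inverse (sigma_min (Df 0))"
    and B_nonneg: "B \<ge> 0"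
    and r_pos: "0 < r" and r_le: "r \<le> R" and BMr: "2 * B * M * r \<le> 1"
begin

definition newton_map :: "'a \<Rightarrow> 'a \<Rightarrow> 'a" where
  "newton_map w \<theta> = \<theta> - inv (Df 0) (f \<theta> - w)"

lemma M_pos: "M > 0"
  using sigma_pos by (simp add: M_def)

lemma norm_inv_le: "norm (inv (Df 0) w) \<le> M * norm w"
  using norm_inv_le_if_sigma_min_pos[OF sigma_pos] by (simp add: M_def)

lemma inv_apply: "inv (Df 0) (Df 0 h) = h"
  using bij_if_sigma_min_pos[OF sigma_pos] by (simp add: bij_is_inj)

lemma apply_inv: "Df 0 (inv (Df 0) w) = w"
  using bij_if_sigma_min_pos[OF sigma_pos] by (simp add: bij_is_surj surj_f_inv_f)

lemma bounded_linear_inv: "bounded_linear (inv (Df 0))"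
proof -
  have "linear (inv (Df 0))"
  proof (rule linearI)
    show "inv (Df 0) (u + v) = inv (Df 0) u + inv (Df 0) v" for u v
      by (metis apply_inv blinfun.add_right inv_apply)
    show "inv (Df 0) (c *\<^sub>R u) = c *\<^sub>R inv (Df 0) u" for c u
      by (metis apply_inv blinfun.scaleR_right inv_apply)
  qed
  then show ?thesis
    by (rule linear_conv_bounded_linear[THEN iffD1])
qed

lemmas inv_diff = linear_diff[OF bounded_linear.linear[OF bounded_linear_inv]]

lemma newton_map_fixed_iff: "newton_map w \<theta> = \<theta> \<longleftrightarrow> f \<theta> = w"
proof -
  have "inv (Df 0) u = 0 \<longleftrightarrow> u = 0" for u
    by (metis apply_inv blinfun.zero_right inv_apply)
  then show ?thesis
    by (simp add: newton_map_def)
qed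

text \<open>Mean value inequality on a closed ball. The radius \<open>s\<close> stays free since
  smaller balls have smaller Lipschitz constants; \<open>s < R\<close> keeps the closed ball inside
  the domain of differentiability.\<close>

lemma newton_map_dist_cball:
  assumes "s < R" "norm \<theta> \<le> s" "norm \<theta>' \<le> s"
  shows "norm (newton_map w \<theta> - newton_map w \<theta>') \<le> M * B * s * norm (\<theta> - \<theta>')"
proof (rule differentiable_bound)
  fix t :: 'a assume t: "t \<in> cball 0 s"
  then have tR: "t \<in> ball 0 R"
    using assms by simp
  show "(newton_map w has_derivative (\<lambda>h. h - inv (Df 0) (Df t h))) (at t within cball 0 s)"
  proof (rule has_derivative_at_withinI)
    have "((\<lambda>\<theta>. f \<theta> - w) has_derivative Df t) (at t)"
      using has_derivative_diff[OF deriv[OF tR] has_derivative_const[of w]] by simp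
    from has_derivative_diff[OF has_derivative_ident
        bounded_linear.has_derivative[OF bounded_linear_inv this]]
    show "(newton_map w has_derivative (\<lambda>h. h - inv (Df 0) (Df t h))) (at t)"
      unfolding newton_map_def .
  qed
  show "onorm (\<lambda>h. h - inv (Df 0) (Df t h)) \<le> M * B * s"
  proof (rule onorm_le)
    fix h
    \<comment> \<open>Writing \<open>h\<close> as \<open>inv (Df 0) (Df 0 h)\<close> turns the
      derivative of the Newton map into a difference of derivatives of \<open>f\<close>.\<close>
    have "norm (h - inv (Df 0) (Df t h)) = norm (inv (Df 0) ((Df 0 - Df t) h))"
      by (simp add: blinfun.diff_left inv_diff inv_apply)
    also have "\<dots> \<le> M * norm ((Df 0 - Df t) h)"
      by (rule norm_inv_le)
    also have "\<dots> \<le> M * (B * s * norm h)"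
    proof (rule mult_left_mono)
      have "norm (Df 0 - Df t) \<le> B * s"
        using Lip[OF tR] t B_nonneg by (smt (verit) mem_cball_0 mult_left_mono)
      then show "norm ((Df 0 - Df t) h) \<le> B * s * norm h"
        by (meson mult_right_mono norm_blinfun norm_ge_zero order_trans)
    qed (use M_pos in simp)
    finally show "norm (h - inv (Df 0) (Df t h)) \<le> M * B * s * norm h"
      by (simp add: mult.assoc)
  qed
qed (use assms in auto)

lemma newton_map_dist:
  assumes "\<theta> \<in> ball 0 r" "\<theta>' \<in> ball 0 r"
  shows "norm (newton_map w \<theta> - newton_map w \<theta>') \<le> 1/2 * norm (\<theta> - \<theta>')"
proof -
  \<comment> \<open>The larger of the two norms is strictly below \<open>r\<close>, so the closed
    ball of radius \<open>s\<close> lies in the domain even if \<open>r = R\<close>.\<close>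
  define s where "s = max (norm \<theta>) (norm \<theta>')"
  have s: "s < r"
    using assms by (simp add: s_def)
  have "M * B * s \<le> M * B * r"
    using s M_pos B_nonneg by (intro mult_left_mono) auto
  then have "M * B * s \<le> 1/2"
    using BMr by (simp add: algebra_simps)
  then have "M * B * s * norm (\<theta> - \<theta>') \<le> 1/2 * norm (\<theta> - \<theta>')"
    by (rule mult_right_mono) simp
  then show ?thesis
    using newton_map_dist_cball[of s \<theta> \<theta>' w] s r_le by (simp add: s_def)
qed

lemma newton_map_lipschitz: "(1/2)-lipschitz_on (ball 0 r) (newton_map w)"
  by (rule lipschitz_onI) (use newton_map_dist in \<open>auto simp: dist_norm\<close>)

text \<open>The constant 1/2 alone sends the closed ball of radius \<open>s\<close> into radius
  \<open>(s + r) / 2\<close>, which exceeds \<open>s\<close> for \<open>s < r\<close>. The finer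
  estimate yields a complete invariant ball, as the Banach fixed point theorem requires.\<close>

lemma newton_map_in_cball:
  assumes \<theta>: "\<theta> \<in> ball 0 r" and w: "norm (w - f 0) \<le> r / (2 * M)"
  shows "newton_map w \<theta> \<in> cball 0 (7/8 * r)"
proof -
  let ?n = "norm \<theta>"
  have n: "?n < r"
    using \<theta> by simp
  have 1: "norm (newton_map w \<theta> - newton_map w (\<theta> /\<^sub>R 2)) \<le> M * B * ?n * (?n / 2)"
  proof -
    have "\<theta> - \<theta> /\<^sub>R 2 = \<theta> /\<^sub>R 2"
      using scaleR_half_double[of \<theta>] by (simp add: scaleR_2 algebra_simps)
    then show ?thesis
      using newton_map_dist_cball[of ?n \<theta> "\<theta> /\<^sub>R 2" w] n r_le by simp
  qed
  \<comment> \<open>Both points lie in the ball of radius \<open>?n / 2\<close>, where the Lipschitz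
    constant is halved.\<close>
  have 2: "norm (newton_map w (\<theta> /\<^sub>R 2) - newton_map w 0) \<le> M * B * (?n / 2) * (?n / 2)"
    using newton_map_dist_cball[of "?n / 2" "\<theta> /\<^sub>R 2" 0 w] n r_le r_pos norm_ge_zero[of \<theta>]
    by (smt (verit) diff_zero field_sum_of_halves norm_scaleR norm_zero real_norm_def
        divide_inverse_commute inverse_nonnegative_iff_nonnegative)
  have "norm (newton_map w 0) = norm (inv (Df 0) (w - f 0))"
    by (simp add: newton_map_def inv_diff)
  also have "\<dots> \<le> M * (r / (2 * M))"
    using norm_inv_le[of "w - f 0"] w M_pos by (smt (verit) mult_left_mono)
  finally have 3: "norm (newton_map w 0) \<le> r / 2"
    using M_pos by simp
  have "M * B * (?n * ?n) \<le> M * B * (r * r)"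
    using n M_pos B_nonneg r_pos by (intro mult_left_mono mult_mono) auto
  also have "\<dots> = (2 * B * M * r) * (r / 2)"
    by simp
  also have "\<dots> \<le> 1 * (r / 2)"
    by (rule mult_right_mono[OF BMr]) (use r_pos in simp)
  finally have 4: "M * B * (?n * ?n) \<le> r / 2"
    by simp
  have "norm (newton_map w \<theta>) \<le> norm (newton_map w \<theta> - newton_map w (\<theta> /\<^sub>R 2))
      + norm (newton_map w (\<theta> /\<^sub>R 2) - newton_map w 0) + norm (newton_map w 0)"
    by norm
  \<comment> \<open>The outer half of the segment contributes the factor 1/2 and the inner half 1/4.
    With fact \<open>4\<close> this is at most 3/8 of \<open>r\<close>, and the start value adds 1/2
    of \<open>r\<close>.\<close>
  also have "\<dots> \<le> 3/4 * (M * B * (?n * ?n)) + r / 2"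
    using 1 2 3 by (simp add: algebra_simps)
  also have "\<dots> \<le> 7/8 * r"
    using 4 by linarith
  finally show ?thesis
    by simp
qed

lemma newton_map_image:
  assumes "norm (w - f 0) \<le> r / (2 * M)"
  shows "newton_map w ` ball 0 r \<subseteq> ball 0 r"
  using newton_map_in_cball[OF _ assms] r_pos by fastforce

lemma ex1_solution:
  assumes w: "norm (w - f 0) \<le> r / (2 * M)"
  shows "\<exists>!\<theta>. \<theta> \<in> ball 0 r \<and> f \<theta> = w"
proof -
  have sub: "cball 0 (7/8 * r) \<subseteq> (ball 0 r :: 'a set)"
    using r_pos by auto
  have "\<exists>!\<theta>\<in>cball 0 (7/8 * r). newton_map w \<theta> = \<theta>"
  proof (rule Banach_fix[where c = "1/2"])
    show "newton_map w ` cball 0 (7/8 * r) \<subseteq> cball 0 (7/8 * r)"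
      using newton_map_in_cball[OF _ w] sub by blast
    show "dist (newton_map w \<theta>) (newton_map w \<theta>') \<le> 1/2 * dist \<theta> \<theta>'"
      if "\<theta> \<in> cball 0 (7/8 * r)" "\<theta>' \<in> cball 0 (7/8 * r)" for \<theta> \<theta>'
      unfolding dist_norm by (rule newton_map_dist) (use that sub in blast)+
  qed (use r_pos in \<open>auto simp: complete_eq_closed\<close>)
  then have "\<exists>!\<theta>. \<theta> \<in> cball 0 (7/8 * r) \<and> f \<theta> = w"
    by (simp only: newton_map_fixed_iff)
  \<comment> \<open>A solution in the open ball is a fixed point, hence its own image, and so
    already lies in the smaller closed ball. Uniqueness thus extends to the open ball.\<close>
  moreover have "\<theta> \<in> ball 0 r \<and> f \<theta> = w \<longleftrightarrow> \<theta> \<in> cball 0 (7/8 * r) \<and> f \<theta> = w" for \<theta>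
    using newton_map_in_cball[of \<theta> w] w sub newton_map_fixed_iff[of w \<theta>] by auto
  ultimately show ?thesis
    by simp
qed

text \<open>The contraction estimate absorbs half of the left-hand side. The target \<open>0\<close>
  is arbitrary, since \<open>w\<close> cancels in differences of
  \<open>newton_map w\<close>.\<close>

lemma dist_le_dist_values:
  assumes "\<theta> \<in> ball 0 r" "\<theta>' \<in> ball 0 r"
  shows "norm (\<theta> - \<theta>') \<le> 2 * M * norm (f \<theta> - f \<theta>')"
proof -
  have "\<theta> - \<theta>' = (newton_map 0 \<theta> - newton_map 0 \<theta>') + inv (Df 0) (f \<theta> - f \<theta>')"
    by (simp add: newton_map_def inv_diff)
  then have "norm (\<theta> - \<theta>') \<le> norm (newton_map 0 \<theta> - newton_map 0 \<theta>') + norm (inv (Df 0) (f \<theta> - f \<theta>'))"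
    by (metis norm_triangle_ineq)
  also have "\<dots> \<le> 1/2 * norm (\<theta> - \<theta>') + M * norm (f \<theta> - f \<theta>')"
    by (intro add_mono newton_map_dist norm_inv_le assms)
  finally show ?thesis
    by simp
qed

lemma newton_iterates_tendsto:
  assumes "norm (w - f 0) \<le> r / (2 * M)" "p \<in> ball 0 r" "f p = w" "\<theta> \<in> ball 0 r"
  shows "(\<lambda>n. (newton_map w ^^ n) \<theta>) \<longlonglongrightarrow> p"
  by (rule tendsto_funpow_contraction[OF _ _ newton_map_image newton_map_lipschitz])
    (use assms newton_map_fixed_iff in auto)

end

section \<open>Realification as an isometry\<close>

lemma norm_realify: "norm (realify y) = norm y"
proof -
  have "(\<Sum>i\<in>UNIV. (realify y $ i)\<^sup>2) = (\<Sum>k\<in>UNIV. (Re (y $ k))\<^sup>2) + (\<Sum>k\<in>UNIV. (Im (y $ k))\<^sup>2)"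
    by (subst UNIV_sum, subst sum.union_disjoint) (auto simp: realify_def sum.reindex)
  then show ?thesis
    by (simp add: norm_vec_def L2_set_def cmod_power2 sum.distrib)
qed

lemma realify_diff: "realify (y - y') = realify y - realify y'"
  by (simp add: realify_def vec_eq_iff split: sum.split)

lemma realify_inject: "realify y = realify y' \<longleftrightarrow> y = y'"
  by (metis norm_realify realify_diff norm_eq_zero right_minus_eq)

section \<open>Local inversion of the Schur sample map\<close>

theorem theorem4p6:
  fixes \<Lambda> \<eta> r\<^sub>d B \<alpha> M\<^sub>0 r \<delta> :: real
    and x :: "real^'m"
    and z :: "complex^'m"
    and H :: "real^('m + 'm) \<Rightarrow> real \<Rightarrow> real^2^2"
    and S :: "real^('m + 'm) \<Rightarrow> complex^'m"
    and DS :: "real^('m + 'm) \<Rightarrow> ((real^('m + 'm)) \<Rightarrow>\<^sub>L (real^('m + 'm)))"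
    and Sinv :: "complex^'m \<Rightarrow> real^('m + 'm)"
    and G :: "complex^'m \<Rightarrow> real^('m + 'm) \<Rightarrow> real^('m + 'm)"
  assumes "\<Lambda> > 0" and "\<eta> > 0" and "r\<^sub>d > 0"
    and z: "\<And>k. z $ k = Complex (x $ k) \<eta>"
    and H: "\<And>\<theta>. \<theta> \<in> ball 0 r\<^sub>d \<Longrightarrow> trace_normed_hamiltonian \<Lambda> (H \<theta>)"
    and S: "S = sample_map H \<Lambda> z"
    and deriv: "\<And>\<theta>. \<theta> \<in> ball 0 r\<^sub>d \<Longrightarrow>
                  ((\<lambda>t. realify (S t)) has_derivative blinfun_apply (DS \<theta>)) (at \<theta>)"
    and C1: "continuous_on (ball 0 r\<^sub>d) DS"
    and "B \<ge> 0"
    and Lip: "\<And>\<theta> \<theta>'. \<lbrakk>\<theta> \<in> ball 0 r\<^sub>d; \<theta>' \<in> ball 0 r\<^sub>d\<rbrakk> \<Longrightarrow>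
                norm (DS \<theta> - DS \<theta>') \<le> B * norm (\<theta> - \<theta>')"
    and \<alpha>: "\<alpha> = sigma_min (DS 0)" and "\<alpha> > 0"
    and M0: "M\<^sub>0 = inverse \<alpha>"
    and r: "r = (if B = 0 then r\<^sub>d else min r\<^sub>d (1 / (2 * B * M\<^sub>0)))"
    and \<delta>: "\<delta> = r / (2 * M\<^sub>0)"
    and Sinv: "Sinv = the_inv_into (ball 0 r) S"
    and G: "\<And>y \<theta>. G y \<theta> = \<theta> - inv (blinfun_apply (DS 0)) (realify (S \<theta>) - realify y)"
  shows "(\<forall>y. norm (y - S 0) \<le> \<delta> \<longrightarrow> (\<exists>!\<theta>. \<theta> \<in> ball 0 r \<and> S \<theta> = y)) \<and>
         (\<forall>y y'. norm (y - S 0) \<le> \<delta> \<longrightarrow> norm (y' - S 0) \<le> \<delta> \<longrightarrow>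
            norm (Sinv y - Sinv y') \<le> 2 * M\<^sub>0 * norm (y - y')) \<and>
         (\<forall>y. norm (y - S 0) \<le> \<delta> \<longrightarrow>
            G y ` ball 0 r \<subseteq> ball 0 r \<and>
            (\<exists>c<1. c-lipschitz_on (ball 0 r) (G y)) \<and>
            (\<forall>\<theta>\<^sub>0\<in>ball 0 r. (\<lambda>n. (G y ^^ n) \<theta>\<^sub>0) \<longlonglongrightarrow> Sinv y))"
proof -
  have M: "M\<^sub>0 > 0"
    using M0 \<open>\<alpha> > 0\<close> by simp
  have rpos: "0 < r" and rle: "r \<le> r\<^sub>d"
    using r \<open>r\<^sub>d > 0\<close> \<open>B \<ge> 0\<close> M by auto
  \<comment> \<open>For \<open>B = 0\<close> the product vanishes, in accordance with the convention
    that \<open>1 / (2 * B * M\<^sub>0)\<close> is then infinite.\<close>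
  have BMr: "2 * B * M\<^sub>0 * r \<le> 1"
  proof (cases "B = 0")
    case False
    then have "2 * B * M\<^sub>0 > 0" "r \<le> 1 / (2 * B * M\<^sub>0)"
      using \<open>B \<ge> 0\<close> M r by auto
    then show ?thesis
      by (simp add: pos_le_divide_eq mult.commute)
  qed simp
  interpret simplified_newton "\<lambda>t. realify (S t)" DS r\<^sub>d B M\<^sub>0 r
  proof
    show "norm (DS 0 - DS \<theta>) \<le> B * norm \<theta>" if "\<theta> \<in> ball 0 r\<^sub>d" for \<theta>
      using Lip[of 0 \<theta>] that \<open>r\<^sub>d > 0\<close> by simp
  qed (use deriv \<alpha> \<open>\<alpha> > 0\<close> M0 \<open>B \<ge> 0\<close> rpos rle BMr in auto)
  have G_eq: "G y = newton_map (realify y)" for y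
    by (simp add: fun_eq_iff G newton_map_def)
  have close: "norm (realify y - realify (S 0)) \<le> r / (2 * M\<^sub>0)" if "norm (y - S 0) \<le> \<delta>" for y
    using that by (simp add: norm_realify \<delta> flip: realify_diff)
  have ex1: "\<exists>!\<theta>. \<theta> \<in> ball 0 r \<and> S \<theta> = y" if "norm (y - S 0) \<le> \<delta>" for y
    using ex1_solution[OF close[OF that]] by (simp add: realify_inject)
  \<comment> \<open>\<open>the_inv_into\<close> calls for injectivity on the whole ball.
    \<open>ex1\<close> covers only values within \<delta> of \<open>S 0\<close>, so the distance
    estimate is used instead.\<close>
  have inj: "inj_on S (ball 0 r)"
  proof (rule inj_onI)
    fix \<theta> \<theta>' assume "\<theta> \<in> ball 0 r" "\<theta>' \<in> ball 0 r" "S \<theta> = S \<theta>'"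
    then show "\<theta> = \<theta>'"
      using dist_le_dist_values[of \<theta> \<theta>'] by simp
  qed
  have Sinv_in: "Sinv y \<in> ball 0 r" and S_Sinv: "S (Sinv y) = y" if y: "norm (y - S 0) \<le> \<delta>" for y
  proof -
    obtain \<theta> where "\<theta> \<in> ball 0 r" "S \<theta> = y"
      using ex1[OF y] by blast
    then show "Sinv y \<in> ball 0 r" "S (Sinv y) = y"
      using the_inv_into_f_f[OF inj] by (auto simp: Sinv)
  qed
  have "norm (Sinv y - Sinv y') \<le> 2 * M\<^sub>0 * norm (y - y')"
    if "norm (y - S 0) \<le> \<delta>" "norm (y' - S 0) \<le> \<delta>" for y y'
    using dist_le_dist_values[OF Sinv_in[OF that(1)] Sinv_in[OF that(2)]] S_Sinv that
    by (simp add: norm_realify flip: realify_diff)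
  moreover have "G y ` ball 0 r \<subseteq> ball 0 r" if "norm (y - S 0) \<le> \<delta>" for y
    unfolding G_eq by (rule newton_map_image[OF close[OF that]])
  \<comment> \<open>The constant 1/2 is uniform in \<open>y\<close>, because \<open>y\<close> enters
    the map only as a translation.\<close>
  moreover have "\<exists>c<1. c-lipschitz_on (ball 0 r) (G y)" for y
    unfolding G_eq by (rule exI[of _ "1/2"]) (simp add: newton_map_lipschitz)
  moreover have "(\<lambda>n. (G y ^^ n) \<theta>\<^sub>0) \<longlonglongrightarrow> Sinv y"
    if "norm (y - S 0) \<le> \<delta>" "\<theta>\<^sub>0 \<in> ball 0 r" for y \<theta>\<^sub>0
    unfolding G_eq using newton_iterates_tendsto[OF close Sinv_in _ that(2)] that(1) S_Sinv by simp
  ultimately show ?thesis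
    using ex1 by blast
qed

end
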